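(* Let $S\in M_{2n}(\mathbb{C})$ be symplectic with eigenvalues $\lambda_1,\lambda_1^{-1},\lambda_2,\lambda_2^{-1},\ldots,\lambda_n,\lambda_n^{-1}$ and let $\mu\in\mathbb{C}\setminus\{0\}$ with $\mu\notin\sigma(S)$ be given. Assume that $\lambda_1$ is a simple eigenvalue of $S$. Let $x_1,x_2\in\mathbb{C}^{2n}$ be eigenvectors of $S$ for $\lambda_1$ and $\lambda_1^{-1}$, respectively, normalized such that $X=[\,x_1\;x_2\,]\in M_{2n\times 2}(\mathbb{C})$ satisfies $X^TJX=J_2$, let $R=[r_{ij}]\in M_2(\mathbb{C})$ satisfy $$(\mu+\mu^{-1})-(\lambda_1+\lambda_1^{-1}) = \lambda_1r_{12}-\lambda_1^{-1}r_{21}\quad\text{and}\quad 0=r_{12}-r_{21}+r_{11}r_{22}-r_{12}r_{21},$$ and let $\hat{S}=S+XRX^TJ^TS$, so that $\mu,\mu^{-1},\lambda_2,\lambda_2^{-1},\ldots,\lambda_n,\lambda_n^{-1}$ are the eigenvalues of $\hat{S}$. Then the following holds: (i) If $\nu$ is a simple eigenvalue of $\hat{S}$ with $\nu\neq\mu$ and $\nu\neq\mu^{-1}$, then $\kappa(\hat{S},\nu)=\kappa(S,\nu)$. (ii) For $R=R_1:=\begin{bmatrix} 0 & \lambda_1^{-1}(\mu-\lambda_1)\\ \mu^{-1}(\mu-\lambda_1) & 0\end{bmatrix}$ it holds that $$\kappa(\hat{S},\mu)=\kappa(S,\lambda_1)\quad\text{and}\quad\kappa(\hat{S},\mu^{-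1})=\kappa(S,\lambda_1^{-1}).$$
   Context: $M_{m\times n}(\mathbb{C})$ is the set of complex $m\times n$ matrices, $M_n(\mathbb{C})=M_{n\times n}(\mathbb{C})$, $\sigma(S)$ is the spectrum of $S$, $^T$ is the transpose without conjugation, $^H$ is the conjugate transpose. $J=J_{2n} = \begin{bmatrix} 0 & I_n \\ -I_n & 0\end{bmatrix}$ and $J_2=\begin{bmatrix}0&1\\-1&0\end{bmatrix}$; $S\in M_{2n}(\mathbb{C})$ is symplectic if $S^TJS=J$. Lists of eigenvalues are counted with algebraic multiplicity. For a simple eigenvalue $\lambda$ (algebraic multiplicity one) of a square complex matrix $A$, its condition number is $\kappa(A,\lambda)=\|u\|_2\|v\|_2/|v^Hu|$, where $u,v$ are right and left eigenvectors of $A$ for $\lambda$, i.e. $Au=\lambda u$ and $v^HA=\lambda v^H$. *)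

theory Defs
  imports "Jordan_Normal_Form.Schur_Decomposition" "Jordan_Normal_Form.Spectral_Radius"
begin

text \<open>The index \<open>n\<close> is half the size: \<open>symp_J n\<close> is a \<open>2n \<times> 2n\<close> matrix, so \<open>symp_J 1\<close> is \<open>J\<^sub>2\<close>.\<close>

definition symp_J :: "nat \<Rightarrow> complex mat" where
  "symp_J n = four_block_mat (0\<^sub>m n n) (1\<^sub>m n) (- 1\<^sub>m n) (0\<^sub>m n n)"

definition symplectic :: "nat \<Rightarrow> complex mat \<Rightarrow> bool" where
  "symplectic n S \<longleftrightarrow>
     S \<in> carrier_mat (2 * n) (2 * n) \<and> transpose_mat S * symp_J n * S = symp_J n"

definition alg_mult :: "complex mat \<Rightarrow> complex \<Rightarrow> nat" where
  "alg_mult A l = order l (char_poly A)"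

definition simple_eigenvalue :: "complex mat \<Rightarrow> complex \<Rightarrow> bool" where
  "simple_eigenvalue A l \<longleftrightarrow> eigenvalue A l \<and> alg_mult A l = 1"

text \<open>\<open>mat_of_row (conjugate v)\<close> is the row vector \<open>v\<^sup>H\<close>.\<close>

definition left_eigenvector :: "complex mat \<Rightarrow> complex vec \<Rightarrow> complex \<Rightarrow> bool" where
  "left_eigenvector A v l \<longleftrightarrow>
     v \<in> carrier_vec (dim_row A) \<and> v \<noteq> 0\<^sub>v (dim_row A) \<and>
     mat_of_row (conjugate v) * A = l \<cdot>\<^sub>m mat_of_row (conjugate v)"

definition norm2_vec :: "complex vec \<Rightarrow> real" where
  "norm2_vec u = sqrt (\<Sum>i<dim_vec u. (cmod (u $ i))\<^sup>2)"

text \<open>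
  The scalar product \<open>u \<bullet>c v\<close> conjugates its second argument, so it equals \<open>v\<^sup>H u\<close>. The description
  is meaningful only if \<open>l\<close> is a simple eigenvalue of \<open>A\<close>: then the eigenvectors are unique up to
  nonzero scalars, which cancel in the quotient.
\<close>

definition cond_number :: "complex mat \<Rightarrow> complex \<Rightarrow> real" where
  "cond_number A l =
     (THE c. \<exists>u v. eigenvector A u l \<and> left_eigenvector A v l \<and>
        c = norm2_vec u * norm2_vec v / cmod (u \<bullet>c v))"

end

theory Submission
  imports Defs
begin

text \<open>
  Put \<open>y\<^sub>i = J x\<^sub>i\<close> and \<open>Y = J X\<close>, and write \<open>S'\<close> for \<open>Shat\<close>. The update is multiplicative, \<open>S' = (I + K) S\<close> with
  \<open>K = X R Y\<^sup>T\<close>, and \<open>S'\<^sup>T = S\<^sup>T (I + K\<^sup>T)\<close> with \<open>K\<^sup>T = Y R\<^sup>T X\<^sup>T\<close>. So \<open>K\<close> only sees a vector through its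
  pairings with \<open>y\<^sub>1, y\<^sub>2\<close>, and \<open>K\<^sup>T\<close> only through its pairings with \<open>x\<^sub>1, x\<^sub>2\<close>. Here \<open>x\<^sub>1, x\<^sub>2\<close> are
  eigenvectors of \<open>S\<close> for \<open>\<lambda>\<^sub>1\<close> and its reciprocal, while \<open>y\<^sub>1, y\<^sub>2\<close> are eigenvectors of \<open>S\<^sup>T\<close> for the
  reciprocal of \<open>\<lambda>\<^sub>1\<close> and for \<open>\<lambda>\<^sub>1\<close> (\<open>symplectic_left_eigenvector\<close>).

  The spectrum: on the span of \<open>X\<close>, invariant under \<open>S\<close>, the update replaces the action of \<open>S\<close> by a
  \<open>2 \<times> 2\<close> matrix, and the rest of the characteristic polynomial is unchanged (\<open>char_poly_rado\<close>). The
  two equations for the entries of \<open>R\<close> say precisely that this matrix has the trace and the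
  determinant of \<open>diag(\<mu>, 1/\<mu>)\<close>.

  The condition numbers: at a simple eigenvalue both eigenspaces are lines
  (\<open>simple_eigenvector_unique\<close>), so it suffices that the two matrices share a right and a left
  eigenvector (\<open>cond_number_cong\<close>). If \<open>\<nu>\<close> is a simple eigenvalue of \<open>S'\<close> other than \<open>\<mu>\<close> and its
  reciprocal, it differs from \<open>\<lambda>\<^sub>1\<close> and its reciprocal, because these have been removed from the
  spectrum. Left and right eigenvectors for different eigenvalues are orthogonal, so \<open>K\<close> and \<open>K\<^sup>T\<close>
  annihilate the eigenvectors of \<open>S\<close> and \<open>S\<^sup>T\<close> for \<open>\<nu>\<close>, which therefore remain eigenvectors of \<open>S'\<close>
  and \<open>S'\<^sup>T\<close>. For an antidiagonal \<open>R\<close> the vectors \<open>x\<^sub>1, x\<^sub>2\<close> are themselves eigenvectors of \<open>K\<close>, and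
  \<open>y\<^sub>1, y\<^sub>2\<close> of \<open>K\<^sup>T\<close>; the eigenvector pairs \<open>x\<^sub>1, y\<^sub>2\<close> and \<open>x\<^sub>2, y\<^sub>1\<close> survive, and only the
  eigenvalues move, from \<open>\<lambda>\<^sub>1\<close> to \<open>\<mu>\<close> and between the reciprocals.
\<close>

section \<open>Characteristic polynomials under updates on an invariant subspace\<close>

text \<open>
  Rado's generalization of Brauer's theorem. If the columns of \<open>X\<close> span an invariant subspace on
  which \<open>A\<close> acts as \<open>L\<close>, an update \<open>X C\<close> changes the action there from \<open>L\<close> to \<open>L + C X\<close> and leaves
  the action on the quotient as it was; so only the factor belonging to the subspace changes. Instead
  of choosing a complement of the subspace, the proof compares two similar block triangular matrices
  of size \<open>n + k\<close>, with diagonal blocks \<open>A + X C, L\<close> and \<open>A, L + C X\<close>.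
\<close>

lemma char_poly_rado:
  fixes A X C L :: "complex mat"
  assumes A: "A \<in> carrier_mat n n" and X: "X \<in> carrier_mat n k"
    and C: "C \<in> carrier_mat k n" and L: "L \<in> carrier_mat k k"
    and AX: "A * X = X * L"
  shows "char_poly (A + X * C) * char_poly L = char_poly A * char_poly (L + C * X)"
proof -
  let ?M = "L + C * X"
  let ?P = "four_block_mat (1\<^sub>m n) X (0\<^sub>m k n) (1\<^sub>m k)"
  let ?Q = "four_block_mat (1\<^sub>m n) (- X) (0\<^sub>m k n) (1\<^sub>m k)"
  let ?B = "four_block_mat A (0\<^sub>m n k) C ?M"
  let ?D = "four_block_mat (A + X * C) (0\<^sub>m n k) C L"
  have M: "?M \<in> carrier_mat k k" and AXC: "A + X * C \<in> carrier_mat n n"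
    using A X C L by auto
  have minus_zero: "- 0\<^sub>m k k = (0\<^sub>m k k :: complex mat)" by auto
  have cancel: "X + - X = 0\<^sub>m n k" using X by (intro eq_matI) auto
  (* \<open>?Q\<close> is the inverse of \<open>?P\<close>. Conjugating \<open>?B\<close> by the shear \<open>?P\<close> moves the update
     from the lower right block, where it is \<open>C X\<close>, to the upper left one, where it is \<open>X C\<close>; the
     upper right block stays zero because \<open>X\<close> intertwines \<open>A\<close> and \<open>L\<close>. *)
  have PQ: "?P * ?Q = 1\<^sub>m (n + k)"
    by (subst mult_four_block_mat[of _ n n _ k _ k _ _ n _ k]) (use X in \<open>auto simp: minus_zero cancel\<close>)
  have QP: "?Q * ?P = 1\<^sub>m (n + k)"
    by (subst mult_four_block_mat[of _ n n _ k _ k _ _ n _ k]) (use X in \<open>auto simp: minus_zero cancel\<close>)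
  have PB: "?P * ?B = four_block_mat (A + X * C) (X * ?M) C ?M"
    by (subst mult_four_block_mat[of _ n n _ k _ k _ _ n _ k]) (use A X C L in auto)
  have XM: "X * ?M = A * X + X * (C * X)"
    unfolding AX by (rule mult_add_distrib_mat) (use X C L in auto)
  have XCX: "(A + X * C) * X = A * X + X * (C * X)"
    using add_mult_distrib_mat[OF A _ X, of "X * C"] assoc_mult_mat[OF X C X] X C by simp
  have top: "(A + X * C) * (- X) + X * ?M = 0\<^sub>m n k"
  proof -
    have "(A + X * C) * (- X) = - ((A + X * C) * X)" using A X C by simp
    then show ?thesis unfolding XM XCX using A X C by (intro eq_matI) auto
  qed
  have bottom: "C * (- X) + ?M = L"
  proof -
    have "C * (- X) = - (C * X)" using C X by simp
    then show ?thesis using C X L by (intro eq_matI) auto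
  qed
  have "?P * ?B * ?Q = ?D"
    unfolding PB
    by (subst mult_four_block_mat[of _ n n _ k _ k _ _ n _ k])
      (use A X C L AXC M top bottom in auto)
  then have "similar_mat ?D ?B"
    using PQ QP A X C L AXC M
    by (intro similar_matI[of _ _ ?P ?Q "n + k"]) (auto intro!: four_block_carrier_mat)
  then have "char_poly ?D = char_poly ?B" by (rule char_poly_similar)
  moreover have "char_poly ?D = char_poly (A + X * C) * char_poly L"
    using char_poly_factorized[OF AXC] char_poly_factorized[OF L]
    by (intro char_poly_0_block'[OF refl _ _ AXC C L]) blast+
  moreover have "char_poly ?B = char_poly A * char_poly ?M"
    using char_poly_factorized[OF A] char_poly_factorized[OF M]
    by (intro char_poly_0_block'[OF refl _ _ A C M]) blast+
  ultimately show ?thesis by simp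
qed

lemma char_poly_1x1:
  assumes "A \<in> carrier_mat 1 1"
  shows "char_poly A = [:- A $$ (0, 0), 1:]"
  using assms by (subst char_poly_upper_triangular[of _ 1]) (auto simp: diag_mat_def)

lemma char_poly_2x2:
  assumes "A \<in> carrier_mat 2 2"
  shows "char_poly A =
    [:A $$ (0, 0) * A $$ (1, 1) - A $$ (0, 1) * A $$ (1, 0), - (A $$ (0, 0) + A $$ (1, 1)), 1:]"
proof -
  have cA: "char_poly_matrix A \<in> carrier_mat 2 2" using assms by simp
  have "char_poly A = (\<Sum>i<2. char_poly_matrix A $$ (i, 0) * cofactor (char_poly_matrix A) i 0)"
    unfolding char_poly_def by (rule laplace_expansion_column[OF cA]) simp
  also have "\<dots> = char_poly_matrix A $$ (0, 0) * char_poly_matrix A $$ (1, 1)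
      - char_poly_matrix A $$ (1, 0) * char_poly_matrix A $$ (0, 1)"
    using cA
    by (simp add: numeral_2_eq_2 cofactor_def det_single[of "mat _ _ _"] mat_delete_def)
  also have "\<dots> = [:A $$ (0, 0) * A $$ (1, 1) - A $$ (0, 1) * A $$ (1, 0),
      - (A $$ (0, 0) + A $$ (1, 1)), 1:]"
    using assms by (simp add: char_poly_matrix_def algebra_simps)
  finally show ?thesis .
qed

section \<open>Condition numbers of simple eigenvalues\<close>

lemma simple_eigenvalue_iff_alg_mult:
  assumes "A \<in> carrier_mat n n"
  shows "simple_eigenvalue A l \<longleftrightarrow> alg_mult A l = 1"
  using eigenvalue_root_char_poly[OF assms, of l] order_0I[of "char_poly A" l]
  by (auto simp: simple_eigenvalue_def alg_mult_def)

text \<open>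
  Algebraic multiplicity one forces a one-dimensional eigenspace. The reason is deflation: were there
  two independent eigenvectors for \<open>l\<close>, a rank-one update along the first could move one copy of \<open>l\<close>
  away while the second eigenvector survives, so \<open>l\<close> would have been a root of multiplicity at least
  two.
\<close>

lemma simple_eigenvector_unique:
  fixes A :: "complex mat"
  assumes A: "A \<in> carrier_mat n n" and simple: "alg_mult A l = 1"
    and u: "eigenvector A u l" and u': "eigenvector A u' l"
  obtains c where "c \<noteq> 0" "u' = c \<cdot>\<^sub>v u"
proof -
  have uc: "u \<in> carrier_vec n" "u \<noteq> 0\<^sub>v n" "A *\<^sub>v u = l \<cdot>\<^sub>v u"
    and u'c: "u' \<in> carrier_vec n" "u' \<noteq> 0\<^sub>v n" "A *\<^sub>v u' = l \<cdot>\<^sub>v u'"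
    using u u' A by (auto simp: eigenvector_def)
  obtain i where i: "i < n" "u $ i \<noteq> 0" using uc by force
  (* Subtracting this multiple of \<open>u\<close> kills the \<open>i\<close>-th coordinate of \<open>u'\<close>, so the functional
     reading off coordinate \<open>i\<close> vanishes on \<open>z\<close> but not on \<open>u\<close>. *)
  define c where "c = u' $ i / u $ i"
  define z where "z = u' - c \<cdot>\<^sub>v u"
  have z: "z \<in> carrier_vec n" using uc u'c by (simp add: z_def)
  have zi: "z $ i = 0" using uc u'c i by (simp add: z_def c_def)
  have Az: "A *\<^sub>v z = l \<cdot>\<^sub>v z"
  proof -
    have "A *\<^sub>v z = l \<cdot>\<^sub>v u' - c \<cdot>\<^sub>v (l \<cdot>\<^sub>v u)"
      using A uc u'c by (simp add: z_def mult_minus_distrib_mat_vec mult_mat_vec)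
    also have "\<dots> = l \<cdot>\<^sub>v z"
      using uc u'c by (intro eq_vecI) (simp_all add: z_def algebra_simps)
    finally show ?thesis .
  qed
  have "z = 0\<^sub>v n"
  proof (rule ccontr)
    assume z0: "z \<noteq> 0\<^sub>v n"
    (* Adding \<open>u e\<^sub>i\<^sup>T\<close> moves one copy of \<open>l\<close> to \<open>l + u\<^sub>i\<close> but leaves the eigenvector \<open>z\<close> in place. *)
    let ?X = "mat_of_cols n [u]" and ?C = "mat_of_rows n [unit_vec n i]"
    let ?L = "mat 1 1 (\<lambda>_. l)"
    have AX: "A * ?X = ?X * ?L"
    proof (rule eq_matI)
      fix r s assume rs: "r < dim_row (?X * ?L)" "s < dim_col (?X * ?L)"
      have "(A * ?X) $$ (r, s) = (A *\<^sub>v u) $ r" using rs A uc(1) by simp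
      also have "\<dots> = (?X * ?L) $$ (r, s)"
        using rs A uc by (simp add: scalar_prod_def mat_of_cols_index mult.commute)
      finally show "(A * ?X) $$ (r, s) = (?X * ?L) $$ (r, s)" .
    qed (use A in auto)
    have X: "?X \<in> carrier_mat n 1" and C: "?C \<in> carrier_mat 1 n"
      and L: "?L \<in> carrier_mat 1 1"
      using mat_of_cols_carrier(1)[of n "[u]"] mat_of_rows_carrier(1)[of n "[unit_vec n i]"] by simp_all
    have rado: "char_poly (A + ?X * ?C) * char_poly ?L = char_poly A * char_poly (?L + ?C * ?X)"
      by (rule char_poly_rado[OF A X C L AX])
    have "(?L + ?C * ?X) $$ (0, 0) = l + u $ i" using uc i by simp
    then have chM: "char_poly (?L + ?C * ?X) = [:- (l + u $ i), 1:]"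
      using char_poly_1x1[of "?L + ?C * ?X"] mult_carrier_mat[OF C X] add_carrier_mat[of _ 1 1 ?L]
      by simp
    have chL: "char_poly ?L = [:- l, 1:]" by (subst char_poly_1x1) auto
    have "?C *\<^sub>v z = 0\<^sub>v 1" using z i zi by (intro eq_vecI) simp_all
    then have "(?X * ?C) *\<^sub>v z = 0\<^sub>v n"
      using X C unfolding assoc_mult_mat_vec[OF X C z]
      by (intro eq_vecI) (simp_all add: scalar_prod_def)
    then have "(A + ?X * ?C) *\<^sub>v z = l \<cdot>\<^sub>v z"
      using add_mult_distrib_mat_vec[OF A mult_carrier_mat[OF X C] z] z Az by simp
    moreover have AXC: "A + ?X * ?C \<in> carrier_mat n n" using A X C by auto
    ultimately have "eigenvalue (A + ?X * ?C) l"
      using z z0 unfolding eigenvalue_def eigenvector_def by auto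
    then have "[:- l, 1:] dvd char_poly (A + ?X * ?C)"
      unfolding eigenvalue_root_char_poly[OF AXC] poly_eq_0_iff_dvd .
    then have "[:- l, 1:]^2 dvd char_poly (A + ?X * ?C) * [:- l, 1:]"
      unfolding power2_eq_square by (rule mult_dvd_mono) simp
    then have dvd: "[:- l, 1:]^2 dvd char_poly A * [:- (l + u $ i), 1:]"
      using rado unfolding chM chL by simp
    have ne: "char_poly A \<noteq> 0" using degree_monic_char_poly[OF A] by auto
    then have ne': "char_poly A * [:- (l + u $ i), 1:] \<noteq> 0" unfolding mult_eq_0_iff by simp
    have "order l [:- (l + u $ i), 1:] = 0" using i by (simp add: order_0I)
    then have "order l (char_poly A * [:- (l + u $ i), 1:]) = 1"
      using order_mult[OF ne', of l] simple by (simp add: alg_mult_def)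
    moreover have "2 \<le> order l (char_poly A * [:- (l + u $ i), 1:])"
      using order_max[OF dvd ne'] .
    ultimately show False by simp
  qed
  have u'_eq: "u' = c \<cdot>\<^sub>v u"
  proof (rule eq_vecI)
    fix j assume "j < dim_vec (c \<cdot>\<^sub>v u)"
    then show "u' $ j = (c \<cdot>\<^sub>v u) $ j"
      using arg_cong[OF \<open>z = 0\<^sub>v n\<close>, of "\<lambda>v. v $ j"] uc(1) u'c(1) by (simp add: z_def)
  qed (use uc u'c in simp)
  have "c \<noteq> 0"
  proof
    assume "c = 0"
    then have "u' = 0\<^sub>v n" unfolding u'_eq using uc(1) by (intro eq_vecI) simp_all
    then show False using u'c(2) by simp
  qed
  then show thesis using that u'_eq by blast
qed

text \<open>
  Conjugation turns left eigenvectors into eigenvectors of the transpose. The symplectic structure is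
  bilinear, without conjugation, so left eigenvectors are handled in this form from here on.
\<close>

lemma left_eigenvector_iff:
  assumes A: "A \<in> carrier_mat n n"
  shows "left_eigenvector A v l \<longleftrightarrow> eigenvector (transpose_mat A) (conjugate v) l"
proof (cases "v \<in> carrier_vec n")
  case True
  then have cv: "conjugate v \<in> carrier_vec n" by simp
  have "mat_of_row (conjugate v) * A = l \<cdot>\<^sub>m mat_of_row (conjugate v) \<longleftrightarrow>
      transpose_mat A *\<^sub>v conjugate v = l \<cdot>\<^sub>v conjugate v"
  proof -
    have "mat_of_row (conjugate v) * A = mat_of_row (transpose_mat A *\<^sub>v conjugate v)"
    proof (rule eq_matI)
      fix i j assume "i < dim_row (mat_of_row (transpose_mat A *\<^sub>v conjugate v))" 
       "j < dim_col (mat_of_row (transpose_mat A *\<^sub>v conjugate v))"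
      then show "(mat_of_row (conjugate v) * A) $$ (i, j) = mat_of_row (transpose_mat A *\<^sub>v conjugate v) $$ (i, j)"
        using A cv comm_scalar_prod[OF cv, of "col A j"] by simp
    qed (use A in auto)
    moreover have "l \<cdot>\<^sub>m mat_of_row (conjugate v) = mat_of_row (l \<cdot>\<^sub>v conjugate v)"
      by (rule eq_matI) simp_all
    moreover have "mat_of_row x = mat_of_row y \<longleftrightarrow> x = y" for x y :: "complex vec"
      by (metis row_mat_of_row)
    ultimately show ?thesis by simp
  qed
  then show ?thesis using A True cv conjugate_zero_iff_vec[of v n]
    unfolding left_eigenvector_def eigenvector_def by simp
next
  case False
  then have "conjugate v \<notin> carrier_vec n" unfolding carrier_dim_vec by simp
  then have "\<not> eigenvector (transpose_mat A) (conjugate v) l" "\<not> left_eigenvector A v l"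
    using A False unfolding eigenvector_def left_eigenvector_def by simp_all
  then show ?thesis by simp
qed

lemma norm2_vec_conjugate [simp]: "norm2_vec (conjugate v) = norm2_vec v"
  by (simp add: norm2_vec_def)

lemma norm2_vec_smult: "norm2_vec (c \<cdot>\<^sub>v v) = cmod c * norm2_vec v"
  by (simp add: norm2_vec_def norm_mult power_mult_distrib flip: sum_distrib_left
      add: real_sqrt_mult)

text \<open>
  Since both eigenspaces are lines, the quotient does not depend on the choice of eigenvectors, and
  any pair computes the condition number; \<open>w\<close> is the conjugate of a left eigenvector.
\<close>

lemma cond_number_eq:
  assumes A: "A \<in> carrier_mat n n" and simple: "alg_mult A l = 1"
    and u: "eigenvector A u l" and w: "eigenvector (transpose_mat A) w l"
  shows "cond_number A l = norm2_vec u * norm2_vec w / cmod (u \<bullet> w)"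
  unfolding cond_number_def
proof (rule the_equality)
  show "\<exists>u' v. eigenvector A u' l \<and> left_eigenvector A v l \<and>
      norm2_vec u * norm2_vec w / cmod (u \<bullet> w) = norm2_vec u' * norm2_vec v / cmod (u' \<bullet>c v)"
    using u w A by (intro exI[of _ u] exI[of _ "conjugate w"]) (simp add: left_eigenvector_iff)
next
  fix c
  assume "\<exists>u' v. eigenvector A u' l \<and> left_eigenvector A v l \<and>
      c = norm2_vec u' * norm2_vec v / cmod (u' \<bullet>c v)"
  then obtain u' v where u': "eigenvector A u' l"
    and v: "eigenvector (transpose_mat A) (conjugate v) l"
    and c: "c = norm2_vec u' * norm2_vec v / cmod (u' \<bullet>c v)"
    using A by (auto simp: left_eigenvector_iff)
  have AT: "transpose_mat A \<in> carrier_mat n n" "alg_mult (transpose_mat A) l = 1"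
    using A simple by (simp_all add: alg_mult_def)
  obtain a where a: "a \<noteq> 0" "u' = a \<cdot>\<^sub>v u"
    using simple_eigenvector_unique[OF A simple u u'] .
  obtain b where b: "b \<noteq> 0" "conjugate v = b \<cdot>\<^sub>v w"
    using simple_eigenvector_unique[OF AT w v] .
  have dims: "u \<in> carrier_vec n" "w \<in> carrier_vec n"
    using u w A by (simp_all add: eigenvector_def)
  have "norm2_vec v = cmod b * norm2_vec w"
    using norm2_vec_conjugate[of v] b(2) by (simp add: norm2_vec_smult)
  then show "c = norm2_vec u * norm2_vec w / cmod (u \<bullet> w)"
    using a b dims by (simp add: c norm2_vec_smult norm_mult)
qed

text \<open>
  Condition numbers depend on the eigenvectors only: an update may move an eigenvalue without
  changing its conditioning, as long as the right and the left eigenvector stay in place.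
\<close>

lemma cond_number_cong:
  assumes "A \<in> carrier_mat n n" "B \<in> carrier_mat n n" "simple_eigenvalue A l" "simple_eigenvalue B m"
    and "eigenvector A u l" "eigenvector (transpose_mat A) w l"
    and "eigenvector B u m" "eigenvector (transpose_mat B) w m"
  shows "cond_number A l = cond_number B m"
  using assms cond_number_eq[of A n l u w] cond_number_eq[of B n m u w]
  by (simp add: simple_eigenvalue_def)

lemma transpose_eigenvector_exists:
  fixes A :: "complex mat"
  assumes "A \<in> carrier_mat n n" "eigenvalue A l"
  obtains w where "eigenvector (transpose_mat A) w l"
proof -
  have "eigenvalue (transpose_mat A) l"
    using assms eigenvalue_root_char_poly[of "transpose_mat A" n l]
    by (simp add: eigenvalue_root_char_poly)
  then show thesis using that by (auto simp: eigenvalue_def)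
qed

lemma left_right_eigenvector_orthogonal:
  fixes A :: "'a :: field mat"
  assumes A: "A \<in> carrier_mat n n"
    and u: "u \<in> carrier_vec n" "A *\<^sub>v u = a \<cdot>\<^sub>v u"
    and w: "w \<in> carrier_vec n" "transpose_mat A *\<^sub>v w = b \<cdot>\<^sub>v w" and "a \<noteq> b"
  shows "w \<bullet> u = 0"
proof -
  have "b * (w \<bullet> u) = a * (w \<bullet> u)"
    using transpose_vec_mult_scalar[OF A u(1) w(1)] u w by simp
  then show ?thesis using \<open>a \<noteq> b\<close> by simp
qed

section \<open>Rank-two updates\<close>

text \<open>
  Writing an update as \<open>(I + K) A\<close> makes its effect on common eigenvectors of \<open>A\<close> and \<open>K\<close>
  multiplicative. The case \<open>k = 0\<close> describes an eigenvector that the update does not see.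
\<close>

lemma eigenvector_multiplicative_update:
  fixes A K :: "'a :: field mat"
  assumes A: "A \<in> carrier_mat n n" and K: "K \<in> carrier_mat n n"
    and ev: "eigenvector A u l" and Ku: "K *\<^sub>v u = k \<cdot>\<^sub>v u"
  shows "eigenvector (A + K * A) u (l * (1 + k))"
proof -
  have u: "u \<in> carrier_vec n" "u \<noteq> 0\<^sub>v n" "A *\<^sub>v u = l \<cdot>\<^sub>v u"
    using ev A by (simp_all add: eigenvector_def)
  have "(A + K * A) *\<^sub>v u = l \<cdot>\<^sub>v u + l \<cdot>\<^sub>v (k \<cdot>\<^sub>v u)"
    using A K u Ku
    by (simp add: add_mult_distrib_mat_vec[of _ n n] mult_mat_vec[of _ n n])
  also have "\<dots> = (l * (1 + k)) \<cdot>\<^sub>v u"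
    by (simp add: smult_smult_assoc distrib_left add_smult_distrib_vec)
  finally show ?thesis using u A K by (simp add: eigenvector_def)
qed

lemma eigenvector_transpose_multiplicative_update:
  fixes A K :: "'a :: field mat"
  assumes A: "A \<in> carrier_mat n n" and K: "K \<in> carrier_mat n n"
    and ev: "eigenvector (transpose_mat A) w l" and Kw: "transpose_mat K *\<^sub>v w = k \<cdot>\<^sub>v w"
  shows "eigenvector (transpose_mat (A + K * A)) w (l * (1 + k))"
proof -
  have w: "w \<in> carrier_vec n" "w \<noteq> 0\<^sub>v n" "transpose_mat A *\<^sub>v w = l \<cdot>\<^sub>v w"
    using ev A by (simp_all add: eigenvector_def)
  have "transpose_mat (A + K * A) = transpose_mat A + transpose_mat A * transpose_mat K"
    using A K by (simp add: transpose_add[of _ n n] transpose_mult[of _ n n])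
  then have "transpose_mat (A + K * A) *\<^sub>v w = l \<cdot>\<^sub>v w + k \<cdot>\<^sub>v (l \<cdot>\<^sub>v w)"
    using A K w Kw
    by (simp add: add_mult_distrib_mat_vec[of _ n n] mult_mat_vec[of _ n n])
  also have "\<dots> = (l * (1 + k)) \<cdot>\<^sub>v w"
    by (simp add: smult_smult_assoc distrib_left add_smult_distrib_vec mult.commute)
  finally show ?thesis using w A K by (simp add: eigenvector_def)
qed

lemma mat_of_two_cols_carrier:
  assumes "a \<in> carrier_vec m" "b \<in> carrier_vec m"
  shows "mat_of_cols m [a, b] \<in> carrier_mat m 2"
    and "j < 2 \<Longrightarrow> col (mat_of_cols m [a, b]) j = [a, b] ! j"
  using mat_of_cols_carrier(1)[of m "[a, b]"] assms
  by (auto simp: numeral_2_eq_2 less_Suc_eq)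

lemma rank_two_mult_vec:
  fixes R :: "'a :: comm_ring_1 mat"
  assumes "R \<in> carrier_mat 2 2" "a \<in> carrier_vec m" "b \<in> carrier_vec m"
    and "c \<in> carrier_vec m" "d \<in> carrier_vec m" "z \<in> carrier_vec m"
  shows "(mat_of_cols m [a, b] * R * transpose_mat (mat_of_cols m [c, d])) *\<^sub>v z =
    (R $$ (0, 0) * (c \<bullet> z) + R $$ (0, 1) * (d \<bullet> z)) \<cdot>\<^sub>v a +
    (R $$ (1, 0) * (c \<bullet> z) + R $$ (1, 1) * (d \<bullet> z)) \<cdot>\<^sub>v b"
proof -
  let ?X = "mat_of_cols m [a, b]" and ?Y = "mat_of_cols m [c, d]"
  have X: "?X \<in> carrier_mat m 2" and Y: "?Y \<in> carrier_mat m 2"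
    using mat_of_cols_carrier(1)[of m "[a, b]"] mat_of_cols_carrier(1)[of m "[c, d]"]
    by (simp_all add: numeral_2_eq_2)
  have YT: "transpose_mat ?Y \<in> carrier_mat 2 m" using Y by simp
  have Yz: "transpose_mat ?Y *\<^sub>v z \<in> carrier_vec 2" using YT assms by simp
  have "(?X * R * transpose_mat ?Y) *\<^sub>v z = ?X *\<^sub>v (R *\<^sub>v (transpose_mat ?Y *\<^sub>v z))"
    using assoc_mult_mat_vec[OF mult_carrier_mat[OF X assms(1)] YT assms(6)]
      assoc_mult_mat_vec[OF X assms(1) Yz] by simp
  also have "\<dots> = (R $$ (0, 0) * (c \<bullet> z) + R $$ (0, 1) * (d \<bullet> z)) \<cdot>\<^sub>v a +
      (R $$ (1, 0) * (c \<bullet> z) + R $$ (1, 1) * (d \<bullet> z)) \<cdot>\<^sub>v b" (is "_ = ?rhs")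
  proof (rule eq_vecI)
    fix i assume "i < dim_vec ?rhs"
    then have i: "i < m" using assms by simp
    have e: "(transpose_mat ?Y *\<^sub>v z) $ 0 = c \<bullet> z" "(transpose_mat ?Y *\<^sub>v z) $ 1 = d \<bullet> z"
      using assms by simp_all
    have R: "(R *\<^sub>v v) $ j = R $$ (j, 0) * v $ 0 + R $$ (j, 1) * v $ 1"
      if "j < 2" "v \<in> carrier_vec 2" for j v
      using that assms by (simp add: scalar_prod_def numeral_2_eq_2)
    have Rv: "R *\<^sub>v (transpose_mat ?Y *\<^sub>v z) \<in> carrier_vec 2" using assms Yz by simp
    have X': "(?X *\<^sub>v v) $ i = v $ 0 * a $ i + v $ 1 * b $ i" if "v \<in> carrier_vec 2" for v
      using that assms i X
      by (simp add: scalar_prod_def numeral_2_eq_2 mat_of_cols_index mult.commute)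
    show "(?X *\<^sub>v (R *\<^sub>v (transpose_mat ?Y *\<^sub>v z))) $ i = ?rhs $ i"
      using assms i Yz by (simp add: X'[OF Rv] R[OF _ Yz] e del: One_nat_def index_mult_mat_vec)
  qed (use assms in simp)
  finally show ?thesis .
qed

text \<open>
  The two-dimensional case of Rado's theorem with \<open>C = R Y\<^sup>T A\<close>, where the vectors \<open>y\<^sub>i\<close> are paired
  with the eigenvectors \<open>x\<^sub>j\<close> in the same way as \<open>J x\<^sub>i\<close> with \<open>x\<^sub>j\<close> for a normalized symplectic pair.
  The replaced eigenvalues are the roots of the quadratic on the right.
\<close>

lemma char_poly_rank_two_update:
  fixes A R :: "complex mat"
  assumes A: "A \<in> carrier_mat m m" and R: "R \<in> carrier_mat 2 2"
    and x1: "x1 \<in> carrier_vec m" "A *\<^sub>v x1 = l1 \<cdot>\<^sub>v x1"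
    and x2: "x2 \<in> carrier_vec m" "A *\<^sub>v x2 = l2 \<cdot>\<^sub>v x2"
    and y: "y1 \<in> carrier_vec m" "y2 \<in> carrier_vec m"
    and pair: "y1 \<bullet> x1 = 0" "y2 \<bullet> x1 = 1" "y1 \<bullet> x2 = -1" "y2 \<bullet> x2 = 0"
  shows "char_poly (A + mat_of_cols m [x1, x2] * R * transpose_mat (mat_of_cols m [y1, y2]) * A) *
      ([:- l1, 1:] * [:- l2, 1:]) =
    char_poly A *
      [:l1 * l2 * ((1 + R $$ (0, 1)) * (1 - R $$ (1, 0)) + R $$ (0, 0) * R $$ (1, 1)),
        - (l1 * (1 + R $$ (0, 1)) + l2 * (1 - R $$ (1, 0))), 1:]"
proof -
  define X Y where "X = mat_of_cols m [x1, x2]" and "Y = mat_of_cols m [y1, y2]"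
  define L where "L = mat_of_rows_list 2 [[l1, 0], [0, l2]]"
  let ?C = "R * transpose_mat Y * A"
  let ?M = "L + ?C * X"
  note X = mat_of_two_cols_carrier[OF x1(1) x2(1), folded X_def]
    and Y = mat_of_two_cols_carrier[OF y, folded Y_def]
  have L: "L \<in> carrier_mat 2 2" by (auto simp: L_def mat_of_rows_list_def numeral_2_eq_2)
  have YT: "transpose_mat Y \<in> carrier_mat 2 m" using Y(1) by simp
  have RYT: "R * transpose_mat Y \<in> carrier_mat 2 m" using R YT by simp
  have C: "?C \<in> carrier_mat 2 m" using RYT A by simp
  have AX: "A * X = X * L"
  proof (rule eq_matI)
    fix i j assume ij: "i < dim_row (X * L)" "j < dim_col (X * L)"
    then have ij': "i < m" "j = 0 \<or> j = 1" using X L by auto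
    have "(A * X) $$ (i, j) = (A *\<^sub>v ([x1, x2] ! j)) $ i" using ij A X L by simp
    also have "\<dots> = (X * L) $$ (i, j)"
      using ij' x1 x2
      by (auto simp: scalar_prod_def numeral_2_eq_2 X_def L_def mat_of_rows_list_def mat_of_cols_index)
    finally show "(A * X) $$ (i, j) = (X * L) $$ (i, j)" .
  qed (use A X L in auto)
  have XC: "X * ?C = X * R * transpose_mat Y * A"
    unfolding assoc_mult_mat[OF X(1) R YT] assoc_mult_mat[OF X(1) RYT A] by (rule refl)
  have YX: "transpose_mat Y * X = mat_of_rows_list 2 [[0, -1], [1, 0]]"
  proof (rule eq_matI)
    fix i j assume "i < dim_row (mat_of_rows_list 2 [[0, -1], [1, 0 :: complex]])"
      "j < dim_col (mat_of_rows_list 2 [[0, -1], [1, 0 :: complex]])"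
    then have ij: "i = 0 \<or> i = 1" "j = 0 \<or> j = 1" by (auto simp: mat_of_rows_list_def)
    then have "(transpose_mat Y * X) $$ (i, j) = [y1, y2] ! i \<bullet> [x1, x2] ! j"
      using X Y by auto
    then show "(transpose_mat Y * X) $$ (i, j) = mat_of_rows_list 2 [[0, -1], [1, 0]] $$ (i, j)"
      using ij by (auto simp: mat_of_rows_list_def pair)
  qed (use X Y in \<open>auto simp: mat_of_rows_list_def\<close>)
  (* The pairing enters only through \<open>Y\<^sup>T X\<close>, so the compressed matrix is \<open>M = (I + R J\<^sub>2\<^sup>T) L\<close>,
     whose determinant and trace are the coefficients claimed. *)
  have "?C * X = R * ((transpose_mat Y * X) * L)"
    unfolding assoc_mult_mat[OF RYT A X(1)] AX assoc_mult_mat[OF YT X(1) L]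
    using X(1) L by (intro assoc_mult_mat[OF R YT, of _ 2]) simp
  then have M: "?M = mat_of_rows_list 2
      [[l1 * (1 + R $$ (0, 1)), - l2 * R $$ (0, 0)], [l1 * R $$ (1, 1), l2 * (1 - R $$ (1, 0))]]"
    using R unfolding YX
    by (intro eq_matI)
      (auto simp: less_Suc_eq L_def mat_of_rows_list_def scalar_prod_def numeral_2_eq_2 algebra_simps)
  have chM: "char_poly ?M =
      [:l1 * l2 * ((1 + R $$ (0, 1)) * (1 - R $$ (1, 0)) + R $$ (0, 0) * R $$ (1, 1)),
        - (l1 * (1 + R $$ (0, 1)) + l2 * (1 - R $$ (1, 0))), 1:]"
    unfolding M by (subst char_poly_2x2) (auto simp: mat_of_rows_list_def algebra_simps)
  have chL: "char_poly L = [:- l1, 1:] * [:- l2, 1:]"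
    using char_poly_2x2[OF L] by (simp add: L_def mat_of_rows_list_def)
  show ?thesis
    using char_poly_rado[OF A X(1) C L AX]
    unfolding XC chM chL unfolding X_def Y_def .
qed

section \<open>Symplectic matrices and reciprocal roots\<close>

lemma symp_J_carrier: "symp_J n \<in> carrier_mat (2 * n) (2 * n)"
  unfolding symp_J_def mult_2 by (rule four_block_carrier_mat) auto

text \<open>
  Right eigenvectors of a symplectic matrix give left eigenvectors for the reciprocal eigenvalue,
  because \<open>S\<^sup>T J S = J\<close>. The equation is kept free of division, so that \<open>l \<noteq> 0\<close> can be derived from it.
\<close>

lemma symplectic_left_eigenvector:
  assumes "symplectic n S" and x: "x \<in> carrier_vec (2 * n)" "S *\<^sub>v x = l \<cdot>\<^sub>v x"
  shows "l \<cdot>\<^sub>v (transpose_mat S *\<^sub>v (symp_J n *\<^sub>v x)) = symp_J n *\<^sub>v x"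
proof -
  have S: "S \<in> carrier_mat (2 * n) (2 * n)" "transpose_mat S * symp_J n * S = symp_J n"
    using assms(1) by (auto simp: symplectic_def)
  have J: "symp_J n \<in> carrier_mat (2 * n) (2 * n)" by (rule symp_J_carrier)
  have "symp_J n *\<^sub>v x = (transpose_mat S * symp_J n * S) *\<^sub>v x" by (simp add: S)
  also have "\<dots> = transpose_mat S *\<^sub>v (symp_J n *\<^sub>v (S *\<^sub>v x))"
    using S(1) J x(1) by (simp add: assoc_mult_mat_vec[of _ "2*n" "2*n" _ "2*n"])
  also have "\<dots> = l \<cdot>\<^sub>v (transpose_mat S *\<^sub>v (symp_J n *\<^sub>v x))"
    using S(1) J x by (simp add: mult_mat_vec[of _ "2*n" "2*n"])
  finally show ?thesis by simp
qed

lemma order_linear_factor: "order z [:- a, 1:] = (if z = a then 1 else 0)" for a :: complex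
  using order_linear_power[of z "- a" 1] by auto

lemma order_two_linear_factors:
  fixes q :: "complex poly"
  assumes "q \<noteq> 0"
  shows "order z ([:- a, 1:] * [:- b, 1:] * q) =
    (if z = a then 1 else 0) + (if z = b then 1 else 0) + order z q"
proof -
  have ab: "[:- a, 1:] * [:- b, 1:] \<noteq> 0" by (metis mult_eq_0_iff pCons_eq_0_iff zero_neq_one)
  then have "[:- a, 1:] * [:- b, 1:] * q \<noteq> 0" using assms mult_eq_0_iff by blast
  from order_mult[OF this] order_mult[OF ab] show ?thesis by (simp only: order_linear_factor)
qed

text \<open>
  Inversion permutes the roots of each factor; the convention \<open>inverse 0 = 0\<close> covers a root \<open>0\<close>.
\<close>

lemma reciprocal_root_iff:
  fixes a :: "'b \<Rightarrow> complex"
  assumes "finite I"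
  shows "poly (\<Prod>i\<in>I. [:- a i, 1:] * [:- inverse (a i), 1:]) (inverse z) = 0 \<longleftrightarrow>
    poly (\<Prod>i\<in>I. [:- a i, 1:] * [:- inverse (a i), 1:]) z = 0"
proof -
  have "inverse z = a i \<longleftrightarrow> z = inverse (a i)" for i by (metis inverse_inverse_eq)
  then have "poly ([:- a i, 1:] * [:- inverse (a i), 1:]) (inverse z) = 0 \<longleftrightarrow>
      poly ([:- a i, 1:] * [:- inverse (a i), 1:]) z = 0" for i
    unfolding poly_mult mult_eq_0_iff by (auto simp: add_eq_0_iff)
  then show ?thesis using assms by (simp only: poly_prod prod_zero_iff)
qed

section \<open>Condition numbers under the symplectic update\<close>

theorem theorem9:
  fixes n :: nat and S R X Shat :: "complex mat" and lam :: "nat \<Rightarrow> complex"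
    and mu :: complex and x1 x2 :: "complex vec"
  assumes "n \<ge> 1"
    and "symplectic n S"
    and "char_poly S = (\<Prod>i=1..n. [:- lam i, 1:] * [:- inverse (lam i), 1:])"
    and "mu \<noteq> 0" and "mu \<notin> spectrum S"
    and "simple_eigenvalue S (lam 1)"
    and "eigenvector S x1 (lam 1)" and "eigenvector S x2 (inverse (lam 1))"
    and "X = mat_of_cols (2 * n) [x1, x2]"
    and "transpose_mat X * symp_J n * X = symp_J 1"
    and "R \<in> carrier_mat 2 2"
    and "(mu + inverse mu) - (lam 1 + inverse (lam 1))
           = lam 1 * R $$ (0, 1) - inverse (lam 1) * R $$ (1, 0)"
    and "0 = R $$ (0, 1) - R $$ (1, 0) + R $$ (0, 0) * R $$ (1, 1) - R $$ (0, 1) * R $$ (1, 0)"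
    and "Shat = S + X * R * transpose_mat X * transpose_mat (symp_J n) * S"
  shows "char_poly Shat = [:- mu, 1:] * [:- inverse mu, 1:]
           * (\<Prod>i=2..n. [:- lam i, 1:] * [:- inverse (lam i), 1:])
    \<and>
    (\<forall>nu. simple_eigenvalue Shat nu \<and> nu \<noteq> mu \<and> nu \<noteq> inverse mu \<longrightarrow>
       simple_eigenvalue S nu \<and> cond_number Shat nu = cond_number S nu)
    \<and>
    (R = mat_of_rows_list 2 [[0, inverse (lam 1) * (mu - lam 1)],
                             [inverse mu * (mu - lam 1), 0]] \<longrightarrow>
     mu \<noteq> inverse mu \<longrightarrow>
       simple_eigenvalue Shat mu \<and>
       simple_eigenvalue Shat (inverse mu) \<and> simple_eigenvalue S (inverse (lam 1)) \<and>
       cond_number Shat mu = cond_number S (lam 1) \<and>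
       cond_number Shat (inverse mu) = cond_number S (inverse (lam 1)))"
proof -
  let ?N = "2 * n" and ?J = "symp_J n" and ?l = "lam 1"
  have S: "S \<in> carrier_mat ?N ?N" using assms(2) by (simp add: symplectic_def)
  note J = symp_J_carrier[of n]
  define y1 y2 where "y1 = ?J *\<^sub>v x1" and "y2 = ?J *\<^sub>v x2"
  have x1: "x1 \<in> carrier_vec ?N" "S *\<^sub>v x1 = ?l \<cdot>\<^sub>v x1"
    and x2: "x2 \<in> carrier_vec ?N" "S *\<^sub>v x2 = inverse ?l \<cdot>\<^sub>v x2"
    using assms(7,8) S by (auto simp: eigenvector_def)
  have y: "y1 \<in> carrier_vec ?N" "y2 \<in> carrier_vec ?N"
    using J x1 x2 by (simp_all add: y1_def y2_def)
  note X = mat_of_two_cols_carrier(1)[OF x1(1) x2(1), folded assms(9)]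
    and Xcol = mat_of_two_cols_carrier(2)[OF x1(1) x2(1), folded assms(9)]
  have gram: "[x1, x2] ! i \<bullet> (?J *\<^sub>v ([x1, x2] ! j)) = symp_J 1 $$ (i, j)"
    if "i < 2" "j < 2" for i j
  proof -
    have "symp_J 1 $$ (i, j) = (transpose_mat X * (?J * X)) $$ (i, j)"
      using assms(10) assoc_mult_mat[of "transpose_mat X" 2 ?N ?J ?N X 2] X J by simp
    also have "\<dots> = col X i \<bullet> (?J *\<^sub>v col X j)" using X J that by (simp add: mult_mat_vec_def)
    finally show ?thesis using that by (simp add: Xcol)
  qed
  have pair: "x1 \<bullet> y1 = 0" "x1 \<bullet> y2 = 1" "x2 \<bullet> y1 = -1" "x2 \<bullet> y2 = 0"
    using gram[of 0 0] gram[of 0 1] gram[of 1 0] gram[of 1 1]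
    by (simp_all add: y1_def y2_def symp_J_def)
  then have pair': "y1 \<bullet> x1 = 0" "y2 \<bullet> x1 = 1" "y1 \<bullet> x2 = -1" "y2 \<bullet> x2 = 0"
    using x1 x2 y by (simp_all add: comm_scalar_prod[of _ ?N])
  have y_nz: "y1 \<noteq> 0\<^sub>v ?N" "y2 \<noteq> 0\<^sub>v ?N"
    using pair(2,3) scalar_prod_right_zero[OF x1(1)] scalar_prod_right_zero[OF x2(1)] by auto
  have Sy: "?l \<cdot>\<^sub>v (transpose_mat S *\<^sub>v y1) = y1" "inverse ?l \<cdot>\<^sub>v (transpose_mat S *\<^sub>v y2) = y2"
    using symplectic_left_eigenvector[OF assms(2)] x1 x2 by (simp_all add: y1_def y2_def)
  have l0: "?l \<noteq> 0"
  proof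
    assume "?l = 0"
    then have "y1 = 0 \<cdot>\<^sub>v (transpose_mat S *\<^sub>v y1)" using Sy(1) by simp
    also have "\<dots> = 0\<^sub>v ?N" using S by (intro eq_vecI) simp_all
    finally show False using y_nz(1) by simp
  qed
  have y1: "transpose_mat S *\<^sub>v y1 = inverse ?l \<cdot>\<^sub>v y1"
    using arg_cong[OF Sy(1), of "\<lambda>v. inverse ?l \<cdot>\<^sub>v v"] l0 by (simp add: smult_smult_assoc)
  have y2: "transpose_mat S *\<^sub>v y2 = ?l \<cdot>\<^sub>v y2"
    using arg_cong[OF Sy(2), of "\<lambda>v. ?l \<cdot>\<^sub>v v"] l0 by (simp add: smult_smult_assoc)

  define Y where "Y = mat_of_cols ?N [y1, y2]"
  define K where "K = X * R * transpose_mat Y"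
  have Y: "Y \<in> carrier_mat ?N 2" unfolding Y_def by (rule mat_of_two_cols_carrier[OF y])
  have R: "R \<in> carrier_mat 2 2" by (rule assms(11))
  have JX: "?J * X = Y"
  proof (rule eq_matI)
    fix i j assume ij: "i < dim_row Y" "j < dim_col Y"
    then have ij': "i < ?N" "j = 0 \<or> j = 1" using Y by auto
    have "(?J * X) $$ (i, j) = (?J *\<^sub>v col X j) $ i" using ij Y X J by simp
    also have "\<dots> = Y $$ (i, j)"
      using ij' by (auto simp: Xcol Y_def y1_def y2_def mat_of_cols_index)
    finally show "(?J * X) $$ (i, j) = Y $$ (i, j)" .
  qed (use X Y J in auto)
  have K: "K \<in> carrier_mat ?N ?N" using X R Y by (simp add: K_def)
  have YT: "transpose_mat Y = transpose_mat X * transpose_mat ?J"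
    unfolding JX[symmetric] by (rule transpose_mult[OF J X])
  have XR: "X * R \<in> carrier_mat ?N 2" using X R by simp
  have Shat: "Shat = S + K * S"
    unfolding assms(14) K_def YT
    using assoc_mult_mat[OF XR, of "transpose_mat X" ?N "transpose_mat ?J" ?N] X J by simp
  have KT: "transpose_mat K = Y * transpose_mat R * transpose_mat X"
  proof -
    have "transpose_mat K = Y * transpose_mat (X * R)"
      using transpose_mult[OF XR, of "transpose_mat Y" ?N] Y by (simp add: K_def)
    also have "\<dots> = Y * (transpose_mat R * transpose_mat X)" by (simp add: transpose_mult[OF X R])
    also have "\<dots> = Y * transpose_mat R * transpose_mat X"
      using assoc_mult_mat[of Y ?N 2 "transpose_mat R" 2 "transpose_mat X" ?N] X R Y by simp
    finally show ?thesis .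
  qed
  have Shat_carrier: "Shat \<in> carrier_mat ?N ?N" using S K by (simp add: Shat)
  have K_vec: "K *\<^sub>v z = (R $$ (0, 0) * (y1 \<bullet> z) + R $$ (0, 1) * (y2 \<bullet> z)) \<cdot>\<^sub>v x1 +
      (R $$ (1, 0) * (y1 \<bullet> z) + R $$ (1, 1) * (y2 \<bullet> z)) \<cdot>\<^sub>v x2"
    if "z \<in> carrier_vec ?N" for z
    unfolding K_def Y_def assms(9) by (rule rank_two_mult_vec) (use that x1 x2 y R in auto)
  have KT_vec: "transpose_mat K *\<^sub>v z = (R $$ (0, 0) * (x1 \<bullet> z) + R $$ (1, 0) * (x2 \<bullet> z)) \<cdot>\<^sub>v y1 +
      (R $$ (0, 1) * (x1 \<bullet> z) + R $$ (1, 1) * (x2 \<bullet> z)) \<cdot>\<^sub>v y2"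
    if "z \<in> carrier_vec ?N" for z
    using rank_two_mult_vec[of "transpose_mat R" y1 ?N y2 x1 x2 z] that x1 x2 y R
    by (simp add: KT Y_def assms(9))
  have right: "eigenvector Shat u (nu * (1 + k))"
    if "eigenvector S u nu" "K *\<^sub>v u = k \<cdot>\<^sub>v u" for u nu k
    unfolding Shat by (rule eigenvector_multiplicative_update[OF S K that])
  have left: "eigenvector (transpose_mat Shat) w (nu * (1 + k))"
    if "eigenvector (transpose_mat S) w nu" "transpose_mat K *\<^sub>v w = k \<cdot>\<^sub>v w" for w nu k
    unfolding Shat by (rule eigenvector_transpose_multiplicative_update[OF S K that])

  (* The part of the characteristic polynomial that the update does not touch. *)
  let ?Q = "\<Prod>i=2..n. [:- lam i, 1:] * [:- inverse (lam i), 1:]"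
  have chS: "char_poly S = [:- ?l, 1:] * [:- inverse ?l, 1:] * ?Q"
    unfolding assms(3) prod.atLeast_Suc_atMost[OF assms(1)] by (simp only: Suc_1)
  have Q0: "?Q \<noteq> 0"
  proof
    assume "?Q = 0"
    then have "char_poly S = 0" unfolding chS by (simp only: mult_zero_right)
    then show False using degree_monic_char_poly[OF S] by simp
  qed
  have chShat: "char_poly Shat = [:- mu, 1:] * [:- inverse mu, 1:] * ?Q"
  proof -
    let ?p = "[:- ?l, 1:] * [:- inverse ?l, 1:]"
    let ?r = "[:?l * inverse ?l * ((1 + R $$ (0, 1)) * (1 - R $$ (1, 0)) + R $$ (0, 0) * R $$ (1, 1)),
        - (?l * (1 + R $$ (0, 1)) + inverse ?l * (1 - R $$ (1, 0))), 1:]"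
    have update: "char_poly Shat * ?p = char_poly S * ?r"
      unfolding Shat K_def Y_def assms(9)
      by (rule char_poly_rank_two_update[OF S R x1 x2 y pair'])
    (* These are the two conditions on \<open>R\<close>. *)
    have det: "(1 + R $$ (0, 1)) * (1 - R $$ (1, 0)) + R $$ (0, 0) * R $$ (1, 1) = 1"
      using assms(13) by (simp add: algebra_simps)
    have trace: "?l * (1 + R $$ (0, 1)) + inverse ?l * (1 - R $$ (1, 0)) = mu + inverse mu"
      using assms(12) by (simp add: algebra_simps)
    have r: "?r = [:- mu, 1:] * [:- inverse mu, 1:]"
      unfolding det trace using l0 assms(4) by simp
    have "char_poly Shat * ?p = [:- mu, 1:] * [:- inverse mu, 1:] * ?Q * ?p"
      unfolding update r chS by (simp only: ac_simps)
    moreover have "?p \<noteq> 0" unfolding mult_eq_0_iff by simp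
    ultimately show ?thesis unfolding mult_cancel_right by blast
  qed

  have mult_S: "alg_mult S z =
      (if z = ?l then 1 else 0) + (if z = inverse ?l then 1 else 0) + order z ?Q" for z
    unfolding alg_mult_def chS by (rule order_two_linear_factors[OF Q0])
  have mult_Shat: "alg_mult Shat z =
      (if z = mu then 1 else 0) + (if z = inverse mu then 1 else 0) + order z ?Q" for z
    unfolding alg_mult_def chShat by (rule order_two_linear_factors[OF Q0])
  note simple_S = simple_eigenvalue_iff_alg_mult[OF S]
    and simple_Shat = simple_eigenvalue_iff_alg_mult[OF Shat_carrier]
  have Q_reciprocal: "order (inverse z) ?Q = 0 \<longleftrightarrow> order z ?Q = 0" for z
    using reciprocal_root_iff[of "{2..n}" lam z] Q0 unfolding order_root by blast
  (* Simplicity of \<open>\<lambda>\<^sub>1\<close> excludes both \<open>\<lambda>\<^sub>1 = \<plusminus>1\<close> and a further occurrence in the list. *)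
  have "alg_mult S ?l = 1" using assms(6) unfolding simple_S .
  then have l: "?l \<noteq> inverse ?l" "order ?l ?Q = 0"
    unfolding mult_S by (auto split: if_splits)
  then have Ql': "order (inverse ?l) ?Q = 0" unfolding Q_reciprocal by simp
  have simple_S': "simple_eigenvalue S (inverse ?l)"
    using l Ql' unfolding simple_S mult_S by auto

  have part1: "simple_eigenvalue S nu \<and> cond_number Shat nu = cond_number S nu"
    if nu: "simple_eigenvalue Shat nu" "nu \<noteq> mu" "nu \<noteq> inverse mu" for nu
  proof -
    have Qnu: "order nu ?Q = 1" using nu unfolding simple_Shat mult_Shat by simp
    then have ne: "nu \<noteq> ?l" "nu \<noteq> inverse ?l" using l Ql' by auto
    then have simple: "simple_eigenvalue S nu" using Qnu unfolding simple_S mult_S by simp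
    obtain u where u: "eigenvector S u nu"
      using simple by (auto simp: simple_eigenvalue_def eigenvalue_def)
    obtain w where w: "eigenvector (transpose_mat S) w nu"
      using transpose_eigenvector_exists[OF S] simple by (auto simp: simple_eigenvalue_def)
    have u': "u \<in> carrier_vec ?N" "S *\<^sub>v u = nu \<cdot>\<^sub>v u" using u S by (simp_all add: eigenvector_def)
    have w': "w \<in> carrier_vec ?N" "transpose_mat S *\<^sub>v w = nu \<cdot>\<^sub>v w"
      using w S by (simp_all add: eigenvector_def)
    (* The eigenvalues of \<open>y\<^sub>1, y\<^sub>2\<close> differ from \<open>\<nu>\<close>, hence the rank-two term annihilates \<open>u\<close>; in the
       same way its transpose annihilates \<open>w\<close>. *)
    have "y1 \<bullet> u = 0" "y2 \<bullet> u = 0"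
      using left_right_eigenvector_orthogonal[OF S u' y(1) y1]
        left_right_eigenvector_orthogonal[OF S u' y(2) y2] ne by simp_all
    then have Ku: "K *\<^sub>v u = 0 \<cdot>\<^sub>v u"
      unfolding K_vec[OF u'(1)] using x1 x2 u' by (intro eq_vecI) simp_all
    have "x1 \<bullet> w = 0" "x2 \<bullet> w = 0"
      using left_right_eigenvector_orthogonal[OF S x1 w'] left_right_eigenvector_orthogonal[OF S x2 w']
        ne x1 x2 w' by (simp_all add: comm_scalar_prod[of w ?N])
    then have Kw: "transpose_mat K *\<^sub>v w = 0 \<cdot>\<^sub>v w"
      unfolding KT_vec[OF w'(1)] using y w' by (intro eq_vecI) simp_all
    have "cond_number Shat nu = cond_number S nu"
      by (rule cond_number_cong[OF Shat_carrier S nu(1) simple _ _ u w])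
        (use right[OF u Ku] left[OF w Kw] in simp_all)
    with simple show ?thesis by simp
  qed

  have part2: "simple_eigenvalue Shat mu \<and> simple_eigenvalue Shat (inverse mu) \<and>
      simple_eigenvalue S (inverse ?l) \<and> cond_number Shat mu = cond_number S ?l \<and>
      cond_number Shat (inverse mu) = cond_number S (inverse ?l)"
    if R1: "R = mat_of_rows_list 2 [[0, inverse ?l * (mu - ?l)], [inverse mu * (mu - ?l), 0]]"
      and mu: "mu \<noteq> inverse mu"
  proof -
    have "poly ?Q mu \<noteq> 0"
      using assms(5) eigenvalue_root_char_poly[OF S, of mu]
      unfolding spectrum_def chS poly_mult mult_eq_0_iff by blast
    then have Qmu: "order mu ?Q = 0" by (rule order_0I)
    then have Qmu': "order (inverse mu) ?Q = 0" unfolding Q_reciprocal .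
    have simple_mu: "simple_eigenvalue Shat mu" "simple_eigenvalue Shat (inverse mu)"
      using Qmu Qmu' mu unfolding simple_Shat mult_Shat by auto
    have R_entries: "R $$ (0, 0) = 0" "R $$ (0, 1) = inverse ?l * (mu - ?l)"
      "R $$ (1, 0) = inverse mu * (mu - ?l)" "R $$ (1, 1) = 0"
      by (simp_all add: R1 mat_of_rows_list_def)
    (* The factors \<open>1 + k\<close> by which the eigenvalues move. *)
    have shift: "?l * (1 + inverse ?l * (mu - ?l)) = mu"
      "inverse ?l * (1 + - (inverse mu * (mu - ?l))) = inverse mu"
      using l0 assms(4) by (simp_all add: field_simps)
    have K_eig: "K *\<^sub>v x1 = (inverse ?l * (mu - ?l)) \<cdot>\<^sub>v x1"
        "K *\<^sub>v x2 = (- (inverse mu * (mu - ?l))) \<cdot>\<^sub>v x2"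
        "transpose_mat K *\<^sub>v y2 = (inverse ?l * (mu - ?l)) \<cdot>\<^sub>v y2"
        "transpose_mat K *\<^sub>v y1 = (- (inverse mu * (mu - ?l))) \<cdot>\<^sub>v y1"
      unfolding K_vec[OF x1(1)] K_vec[OF x2(1)] KT_vec[OF y(1)] KT_vec[OF y(2)] pair pair' R_entries
      by (rule eq_vecI; use x1 x2 y in simp)+
    have ev_y1: "eigenvector (transpose_mat S) y1 (inverse ?l)"
      and ev_y2: "eigenvector (transpose_mat S) y2 ?l"
      using y y_nz y1 y2 S by (simp_all add: eigenvector_def)
    have "cond_number Shat mu = cond_number S ?l"
      by (rule cond_number_cong[OF Shat_carrier S simple_mu(1) assms(6) _ _ assms(7) ev_y2])
        (use right[OF assms(7) K_eig(1)] left[OF ev_y2 K_eig(3)] in \<open>simp_all only: shift\<close>)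
    moreover have "cond_number Shat (inverse mu) = cond_number S (inverse ?l)"
      by (rule cond_number_cong[OF Shat_carrier S simple_mu(2) simple_S' _ _ assms(8) ev_y1])
        (use right[OF assms(8) K_eig(2)] left[OF ev_y1 K_eig(4)] in \<open>simp_all only: shift\<close>)
    ultimately show ?thesis using simple_mu simple_S' by blast
  qed
  show ?thesis using chShat part1 part2 by blast
qed

end
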